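(* Let $s\ge2$ and let $G$ be a fixed $s$-uniform hypergraph of degeneracy $d\in\mathbb N$. Let $\omega=\omega(n)\to\infty$ as $n\to\infty$ and $t=n^{(d-1)/d}\omega$. Then in the semi-random hypergraph process with $r=1$ there exists a strategy $\mathcal S$ such that $$\lim_{n\to\infty}\mathbb P\big[H_t^{(1,s)}\text{ contains a sub-hypergraph isomorphic to } G\big]=1.$$
   Context: Semi-random hypergraph process with parameters $1\le r\le s$ on $[n]$: start with the empty hypergraph $H_0^{(r,s)}$ on $[n]$. In each step $t\ge1$ a set $U_t$ of $r$ vertices is chosen uniformly at random from $\binom{[n]}{r}$; the player, knowing the history and $U_t$, selects $s-r$ vertices $V_t$ (repetitions and overlap with $U_t$ allowed; the choice may be randomized according to a distribution depending on the history and $U_t$, and such a rule is a strategy $\mathcal S$), and the edge $U_t\cup V_t$ (as a multiset of size $s$) is added to form $H_t^{(r,s)}$; parallel edges are allowed. A hypergraph $G$ is $d$-degenerate if every sub-hypergraph $G'\subseteq G$ has minimum degree at most $d$; the degeneracy of $G$ is the smallest such $d$. *)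

theory Defs
  imports "HOL-Probability.Probability" "HOL-Library.Multiset"
begin

text \<open>A common carrier for the ordinary hypergraph \<open>G\<close> and for the hypergraphs built by the process:
  edges are multisets of vertices, and the edges themselves form a multiset (parallel edges).
  Ordinary hypergraphs are singled out by \<open>simple_hypergraph\<close>.\<close>

datatype 'a hypergraph = Hypergraph (verts: "'a set") (edges: "'a multiset multiset")

definition hypergraph :: "'a hypergraph \<Rightarrow> bool" where
  "hypergraph G \<longleftrightarrow> finite (verts G) \<and> (\<forall>e \<in># edges G. set_mset e \<subseteq> verts G)"

definition simple_hypergraph :: "'a hypergraph \<Rightarrow> bool" where
  "simple_hypergraph G \<longleftrightarrow>
     hypergraph G \<and> (\<forall>e. count (edges G) e \<le> 1) \<and> (\<forall>e \<in># edges G. \<forall>v. count e v \<le> 1)"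

definition uniform :: "nat \<Rightarrow> 'a hypergraph \<Rightarrow> bool" where
  "uniform s G \<longleftrightarrow> (\<forall>e \<in># edges G. size e = s)"

definition subhypergraph :: "'a hypergraph \<Rightarrow> 'a hypergraph \<Rightarrow> bool" where
  "subhypergraph G' G \<longleftrightarrow>
     hypergraph G' \<and> verts G' \<subseteq> verts G \<and> edges G' \<subseteq># edges G"

definition isomorphic :: "'a hypergraph \<Rightarrow> 'b hypergraph \<Rightarrow> bool" where
  "isomorphic G H \<longleftrightarrow>
     (\<exists>\<phi>. bij_betw \<phi> (verts G) (verts H) \<and> edges H = image_mset (image_mset \<phi>) (edges G))"

definition contains_copy :: "'b hypergraph \<Rightarrow> 'a hypergraph \<Rightarrow> bool" where
  "contains_copy H G \<longleftrightarrow> (\<exists>H'. subhypergraph H' H \<and> isomorphic G H')"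

definition vertex_degree :: "'a hypergraph \<Rightarrow> 'a \<Rightarrow> nat" where
  "vertex_degree G v = size (filter_mset (\<lambda>e. v \<in># e) (edges G))"

definition min_degree :: "'a hypergraph \<Rightarrow> nat" where
  "min_degree G = Min (vertex_degree G ` verts G)"

text \<open>The minimum degree is meaningful only for a nonempty vertex set, so the hypergraph without
  vertices is excluded from the quantification.\<close>

definition degenerate :: "nat \<Rightarrow> 'a hypergraph \<Rightarrow> bool" where
  "degenerate d G \<longleftrightarrow>
     (\<forall>G'. subhypergraph G' G \<and> verts G' \<noteq> {} \<longrightarrow> min_degree G' \<le> d)"

definition degeneracy :: "'a hypergraph \<Rightarrow> nat" where
  "degeneracy G = (LEAST d. degenerate d G)"

text \<open>A history lists the pairs \<open>(U\<^sub>i, V\<^sub>i)\<close> of the completed steps in chronological order.\<close>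

type_synonym history = "(nat set \<times> nat multiset) list"

type_synonym strategy = "history \<Rightarrow> nat set \<Rightarrow> nat multiset pmf"

definition r_sets :: "nat \<Rightarrow> nat \<Rightarrow> nat set set" where
  "r_sets n r = {U. U \<subseteq> {1..n} \<and> card U = r}"

definition valid_strategy :: "nat \<Rightarrow> nat \<Rightarrow> nat \<Rightarrow> strategy \<Rightarrow> bool" where
  "valid_strategy n r s S \<longleftrightarrow>
     (\<forall>h. \<forall>U \<in> r_sets n r. \<forall>V \<in> set_pmf (S h U). set_mset V \<subseteq> {1..n} \<and> size V = s - r)"

text \<open>The parameter \<open>s\<close> enters the process only through \<open>valid_strategy\<close>. For \<open>n < r\<close> there is
  no set \<open>U\<close> to draw and the distribution below is unspecified.\<close>

primrec history_pmf :: "nat \<Rightarrow> nat \<Rightarrow> strategy \<Rightarrow> nat \<Rightarrow> history pmf" where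
  "history_pmf n r S 0 = return_pmf []"
| "history_pmf n r S (Suc t) =
     bind_pmf (history_pmf n r S t) (\<lambda>h.
     bind_pmf (pmf_of_set (r_sets n r)) (\<lambda>U.
     bind_pmf (S h U) (\<lambda>V.
     return_pmf (h @ [(U, V)]))))"

definition built_hypergraph :: "nat \<Rightarrow> history \<Rightarrow> nat hypergraph" where
  "built_hypergraph n h = Hypergraph {1..n} (mset (map (\<lambda>(U, V). mset_set U + V) h))"

definition semi_random_process :: "nat \<Rightarrow> nat \<Rightarrow> strategy \<Rightarrow> nat \<Rightarrow> nat hypergraph pmf" where
  "semi_random_process n r S t = map_pmf (built_hypergraph n) (history_pmf n r S t)"

end

theory Submission imports Defs begin

text \<open>Order the \<open>k\<close> vertices of \<open>G\<close> so that each vertex is the last one of at most \<open>d\<close> edges, and cut the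
  time into \<open>k d\<close> blocks of length \<open>m\<close>, one for each possible edge: block \<open>i d + j\<close> serves the \<open>j\<close>-th edge
  whose last vertex has rank \<open>i\<close>. The image of the vertex of rank \<open>i\<close> is a vertex \<open>u\<close> with \<open>u mod k = i\<close>
  that is drawn in each of the blocks \<open>i d, \<dots>, i d + d - 1\<close>; the residues make the images distinct.
  In the block of an edge the player always answers with the images of its other vertices, which are
  determined by earlier blocks, so the edge gets built when \<open>u\<close> is drawn. Whether suitable \<open>u\<close> exist
  depends only on the draws. For two vertices, the events of being drawn in a given block are negatively
  correlated, so by the second moment method a suitable \<open>u\<close> is missing with probability at most
  \<open>1 / (\<lfloor>n / k\<rfloor> p\<^sup>d)\<close> with \<open>p \<ge> m / (n + m)\<close>, and this tends to \<open>0\<close> as soon as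
  \<open>m / n\<^bsup>(d-1)/d\<^esup> \<rightarrow> \<infinity>\<close>.\<close>

section \<open>Degenerate vertex orders and the numbering of edges\<close>

lemma subhypergraph_trans:
  "subhypergraph A B \<Longrightarrow> subhypergraph B C \<Longrightarrow> subhypergraph A C"
  unfolding subhypergraph_def by (meson order_trans subset_mset.order_trans)

text \<open>Some vertex has degree at most \<open>d\<close>. It gets the top rank, and induction
  ranks the hypergraph that is left after deleting it together with its edges.\<close>

lemma degenerate_order:
  assumes "hypergraph G" "degenerate d G"
  shows "\<exists>rk. bij_betw rk (verts G) {..<card (verts G)} \<and>
    (\<forall>v\<in>verts G. size (filter_mset (\<lambda>e. v \<in># e \<and> (\<forall>w\<in>#e. rk w \<le> rk v)) (edges G)) \<le> d)"
  using assms
proof (induction "card (verts G)" arbitrary: G)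
  case 0
  then have "verts G = {}" by (auto simp: hypergraph_def)
  then show ?case by (auto simp: bij_betw_def)
next
  case (Suc k)
  note hG = \<open>hypergraph G\<close>
  have fin: "finite (verts G)" using hG by (auto simp: hypergraph_def)
  have ne: "verts G \<noteq> {}" using Suc.hyps by auto
  have "subhypergraph G G" using hG by (auto simp: subhypergraph_def)
  then have "min_degree G \<le> d" using Suc.prems(2) ne by (auto simp: degenerate_def)
  moreover have "min_degree G \<in> vertex_degree G ` verts G"
    unfolding min_degree_def using fin ne by (intro Min_in) auto
  ultimately obtain x where x: "x \<in> verts G" "vertex_degree G x \<le> d" by auto
  define G' where "G' = Hypergraph (verts G - {x}) (filter_mset (\<lambda>e. x \<notin># e) (edges G))"
  have sub: "subhypergraph G' G"
    using hG by (auto simp: subhypergraph_def G'_def hypergraph_def)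
  have card': "k = card (verts G')" using Suc.hyps x fin by (simp add: G'_def)
  have "degenerate d G'"
    using Suc.prems(2) sub subhypergraph_trans unfolding degenerate_def by blast
  then obtain rk where rk: "bij_betw rk (verts G') {..<k}"
    "\<And>v. v \<in> verts G' \<Longrightarrow>
      size (filter_mset (\<lambda>e. v \<in># e \<and> (\<forall>w\<in>#e. rk w \<le> rk v)) (edges G')) \<le> d"
    using Suc.hyps(1)[OF card'] sub card' by (auto simp: subhypergraph_def)
  define rk' where "rk' = rk(x := k)"
  have "bij_betw rk' ({x} \<union> verts G') ({k} \<union> {..<k})"
  proof (rule bij_betw_combine)
    show "bij_betw rk' {x} {k}" by (simp add: rk'_def)
    show "bij_betw rk' (verts G') {..<k}"
      using rk(1) by (rule bij_betw_cong[THEN iffD1, rotated]) (auto simp: rk'_def G'_def)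
  qed auto
  moreover have "{x} \<union> verts G' = verts G" using x by (auto simp: G'_def)
  moreover have "{k} \<union> {..<k} = {..<card (verts G)}" using Suc.hyps(2) by auto
  ultimately have 1: "bij_betw rk' (verts G) {..<card (verts G)}" by simp
  have 2: "size (filter_mset (\<lambda>e. v \<in># e \<and> (\<forall>w\<in>#e. rk' w \<le> rk' v)) (edges G)) \<le> d"
    if v: "v \<in> verts G" for v
  proof (cases "v = x")
    case True
    have "size (filter_mset (\<lambda>e. v \<in># e \<and> (\<forall>w\<in>#e. rk' w \<le> rk' v)) (edges G))
        \<le> vertex_degree G x"
      unfolding vertex_degree_def True
      by (intro size_mset_mono filter_mset_mono_strong) auto
    then show ?thesis using x by simp
  next
    case False
    then have v': "v \<in> verts G'" using v by (simp add: G'_def)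
    then have "rk v < k" using rk(1) by (auto simp: bij_betw_def)
    \<comment> \<open>An edge through \<open>x\<close> has its maximal rank at \<open>x\<close>, so
      it does not count for \<open>v\<close>; the edges that do count all belong to
      \<open>G'\<close>.\<close>
    then have "filter_mset (\<lambda>e. v \<in># e \<and> (\<forall>w\<in>#e. rk' w \<le> rk' v)) (edges G)
        = filter_mset (\<lambda>e. v \<in># e \<and> (\<forall>w\<in>#e. rk w \<le> rk v)) (edges G')"
      unfolding G'_def hypergraph.sel filter_filter_mset using False
      by (intro filter_mset_cong) (auto simp: rk'_def split: if_splits)
    then show ?thesis using rk(2)[OF v'] by simp
  qed
  show ?case using 1 2 by blast
qed

text \<open>No vertex degree exceeds the number of edges, so that number is the witness that
  \<open>LEAST\<close> needs.\<close>

lemma degenerate_degeneracy: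
  assumes "hypergraph G"
  shows "degenerate (degeneracy G) G"
proof -
  have "degenerate (size (edges G)) G"
    unfolding degenerate_def
  proof (intro allI impI, elim conjE)
    fix G' assume s: "subhypergraph G' G" and ne: "verts G' \<noteq> {}"
    then obtain v where v: "v \<in> verts G'" by auto
    have "finite (verts G')" using s by (auto simp: subhypergraph_def hypergraph_def)
    then have "min_degree G' \<le> vertex_degree G' v"
      unfolding min_degree_def using v by simp
    also have "\<dots> \<le> size (edges G')"
      unfolding vertex_degree_def by (intro size_mset_mono) simp
    also have "\<dots> \<le> size (edges G)" using s by (auto simp: subhypergraph_def intro: size_mset_mono)
    finally show "min_degree G' \<le> size (edges G)" .
  qed
  then show ?thesis unfolding degeneracy_def by (rule LeastI)
qed

text \<open>\<open>apex e\<close> is the last vertex of \<open>e\<close>. The at most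
  \<open>d\<close> edges with a common apex get different slots below \<open>d\<close>, and division
  by \<open>d\<close> recovers the rank of the apex, so distinct edges receive distinct block
  numbers.\<close>

lemma degenerate_edge_slots:
  assumes G: "simple_hypergraph G" and deg: "degenerate d G" and ne: "{#} \<notin># edges G"
  obtains rk apex slot where
    "bij_betw rk (verts G) {..<card (verts G)}"
    "\<forall>e\<in>#edges G. apex e \<in># e"
    "\<forall>e\<in>#edges G. \<forall>w\<in>#e - {#apex e#}. rk w < (rk (apex e) :: nat)"
    "\<forall>e\<in>#edges G. slot e < d"
    "inj_on (\<lambda>e. rk (apex e) * d + slot e) (set_mset (edges G))"
proof -
  have hG: "hypergraph G" using G by (simp add: simple_hypergraph_def)
  obtain rk where rk: "bij_betw rk (verts G) {..<card (verts G)}"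
    and le: "\<And>v. v \<in> verts G \<Longrightarrow>
      size (filter_mset (\<lambda>e. v \<in># e \<and> (\<forall>w\<in>#e. rk w \<le> rk v)) (edges G)) \<le> d"
    using degenerate_order[OF hG deg] by blast
  have inj: "inj_on rk (verts G)" using rk by (simp add: bij_betw_def)
  have sub: "set_mset e \<subseteq> verts G" if "e \<in># edges G" for e
    using hG that by (auto simp: hypergraph_def)
  define apex where "apex e = (ARG_MAX rk w. w \<in># e)" for e
  have apex: "apex e \<in># e \<and> (\<forall>w\<in>#e. rk w \<le> rk (apex e))" if e: "e \<in># edges G" for e
  proof -
    have "e \<noteq> {#}" using ne e by auto
    then obtain w where "w \<in># e" by blast
    moreover have "\<forall>y. y \<in># e \<longrightarrow> rk y \<le> Max (rk ` set_mset e)" by simp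
    ultimately show ?thesis
      unfolding apex_def using arg_max_nat_lemma[of "\<lambda>w. w \<in># e" w rk "Suc (Max (rk ` set_mset e))"]
      by (auto simp: less_Suc_eq_le)
  qed
  define E where "E v = {e \<in> set_mset (edges G). apex e = v}" for v
  have "\<exists>g. inj_on g (E v) \<and> g ` E v \<subseteq> {..<d}" if v: "v \<in> verts G" for v
  proof -
    let ?M = "filter_mset (\<lambda>e. v \<in># e \<and> (\<forall>w\<in>#e. rk w \<le> rk v)) (edges G)"
    have "E v \<subseteq> set_mset ?M" using apex by (auto simp: E_def)
    then have "card (E v) \<le> card (set_mset ?M)" by (intro card_mono) auto
    also have "\<dots> = size (mset_set (set_mset ?M))" by simp
    also have "\<dots> \<le> size ?M" by (intro size_mset_mono mset_set_set_mset_msubset)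
    also have "\<dots> \<le> d" by (rule le[OF v])
    finally have "card (E v) \<le> card {..<d}" by simp
    moreover have "finite (E v)" by (simp add: E_def)
    ultimately show ?thesis by (meson card_le_inj finite_lessThan)
  qed
  then obtain g where g: "\<And>v. v \<in> verts G \<Longrightarrow> inj_on (g v) (E v)"
    "\<And>v. v \<in> verts G \<Longrightarrow> g v ` E v \<subseteq> {..<d}" by metis
  have tv: "apex e \<in> verts G" if "e \<in># edges G" for e
    using apex[OF that] sub[OF that] by auto
  have slot: "g (apex e) e < d" if "e \<in># edges G" for e
    using g(2)[OF tv[OF that]] that by (auto simp: E_def)
  show ?thesis
  proof (rule that[OF rk, of apex "\<lambda>e. g (apex e) e"], safe)
    fix e w assume e: "e \<in># edges G" and w: "w \<in># e - {#apex e#}"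
    \<comment> \<open>The apex occurs only once in \<open>e\<close>, so it is absent after the
      removal, and injectivity of \<open>rk\<close> makes the inequality strict.\<close>
    have "count e (apex e) \<le> 1" using G e by (auto simp: simple_hypergraph_def)
    then have "w \<noteq> apex e" using w
      by (metis count_diff count_greater_zero_iff count_single diff_is_0_eq not_gr_zero)
    moreover have "w \<in># e" using w by (meson in_diffD)
    ultimately show "rk w < rk (apex e)"
      using apex[OF e] tv[OF e] sub[OF e] inj by (metis inj_on_def nat_less_le subsetD)
  next
    show "inj_on (\<lambda>e. rk (apex e) * d + g (apex e) e) (set_mset (edges G))"
    proof (rule inj_onI)
      fix e e' assume e: "e \<in># edges G" "e' \<in># edges G"
        and eq: "rk (apex e) * d + g (apex e) e = rk (apex e') * d + g (apex e') e'"
      have d: "d > 0" using slot[OF e(1)] by simp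
      have "rk (apex e) = (rk (apex e) * d + g (apex e) e) div d" using slot[OF e(1)] d by simp
      also have "\<dots> = rk (apex e')" unfolding eq using slot[OF e(2)] d by simp
      finally have r: "rk (apex e) = rk (apex e')" .
      then have t: "apex e = apex e'" using inj tv e by (auto simp: inj_on_def)
      have "g (apex e) e = g (apex e) e'" using eq r t by simp
      then show "e = e'" using g(1)[OF tv[OF e(1)]] e t by (auto simp: E_def inj_on_def)
    qed
  qed (use apex slot in auto)
qed

section \<open>Copies of \<open>G\<close>, the player's strategy and its correctness\<close>

text \<open>Edge multiplicities in \<open>G\<close> are at most one and an injective vertex map
  keeps edges distinct, so the multiset inclusion in \<open>subhypergraph\<close> reduces to
  membership of each image edge.\<close>

lemma contains_copyI:
  assumes G: "simple_hypergraph G" and inj: "inj_on \<phi> (verts G)"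
    and vs: "\<phi> ` verts G \<subseteq> verts H"
    and es: "\<And>e. e \<in># edges G \<Longrightarrow> image_mset \<phi> e \<in># edges H"
  shows "contains_copy H G"
proof -
  let ?H = "Hypergraph (\<phi> ` verts G) (image_mset (image_mset \<phi>) (edges G))"
  have hG: "finite (verts G)" "\<And>e. e \<in># edges G \<Longrightarrow> set_mset e \<subseteq> verts G"
    using G by (auto simp: simple_hypergraph_def hypergraph_def)
  have injE: "inj_on (image_mset \<phi>) (set_mset (edges G))"
  proof (rule inj_onI)
    fix e e' assume e: "e \<in># edges G" "e' \<in># edges G" and eq: "image_mset \<phi> e = image_mset \<phi> e'"
    let ?g = "inv_into (verts G) \<phi>"
    have "image_mset ?g (image_mset \<phi> a) = a" if "a \<in># edges G" for a
      unfolding multiset.map_comp using hG(2)[OF that] inj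
      by (subst multiset.map_cong0[of _ _ id]) auto
    then show "e = e'" using e eq by metis
  qed
  have "count (edges G) e = count (mset_set (set_mset (edges G))) e" for e
    using G by (cases "e \<in># edges G")
      (auto simp: simple_hypergraph_def not_in_iff le_antisym Suc_le_eq)
  then have "edges G = mset_set (set_mset (edges G))" by (rule multiset_eqI)
  then have "image_mset (image_mset \<phi>) (edges G) = mset_set (image_mset \<phi> ` set_mset (edges G))"
    using injE by (metis image_mset_mset_set)
  also have "\<dots> \<subseteq># mset_set (set_mset (edges H))"
    using es by (subst subset_imp_msubset_mset_set) auto
  also have "\<dots> \<subseteq># edges H" by (rule mset_set_set_mset_msubset)
  finally have "subhypergraph ?H H"
    using hG vs by (auto simp: subhypergraph_def hypergraph_def)
  moreover have "isomorphic G ?H"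
    using inj by (auto simp: isomorphic_def bij_betw_def)
  ultimately show ?thesis by (auto simp: contains_copy_def)
qed

text \<open>The default \<open>0\<close> is outside the vertex set \<open>{1..n}\<close>.\<close>

definition draws :: "history \<Rightarrow> nat \<Rightarrow> nat" where
  "draws h \<tau> = (if \<tau> < length h then the_elem (fst (h ! \<tau>)) else 0)"

definition block :: "nat \<Rightarrow> nat \<Rightarrow> nat set" where
  "block m b = {b * m..<Suc b * m}"

definition recurrent :: "nat \<Rightarrow> nat \<Rightarrow> nat \<Rightarrow> nat \<Rightarrow> (nat \<Rightarrow> nat) \<Rightarrow> nat \<Rightarrow> nat \<Rightarrow> bool" where
  "recurrent n k d m f i u \<longleftrightarrow>
     u \<in> {1..n} \<and> u mod k = i \<and> (\<forall>j<d. u \<in> f ` block m (i * d + j))"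

text \<open>Arbitrary if no vertex is recurrent; the guard in \<open>embedding_strategy\<close> keeps the answer valid
  in that case.\<close>

definition chosen :: "nat \<Rightarrow> nat \<Rightarrow> nat \<Rightarrow> nat \<Rightarrow> (nat \<Rightarrow> nat) \<Rightarrow> nat \<Rightarrow> nat" where
  "chosen n k d m f i = (SOME u. recurrent n k d m f i u)"

text \<open>The next step has index \<open>length h\<close> and so lies in block
  \<open>length h div m\<close>. In blocks that serve no edge \<open>target\<close> may be
  arbitrary; the fallback vertex \<open>1\<close> is legal as soon as some \<open>U\<close> can be
  drawn.\<close>

definition embedding_strategy ::
    "nat \<Rightarrow> nat \<Rightarrow> nat \<Rightarrow> ((nat \<Rightarrow> nat) \<Rightarrow> 'a \<Rightarrow> nat) \<Rightarrow> (nat \<Rightarrow> 'a multiset) \<Rightarrow> strategy" where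
  "embedding_strategy n s m \<phi> target h U =
     (let V = image_mset (\<phi> (draws h)) (target (length h div m)) in
      return_pmf (if set_mset V \<subseteq> {1..n} \<and> size V = s - 1 then V else replicate_mset (s - 1) 1))"

lemma valid_embedding_strategy: "valid_strategy n 1 s (embedding_strategy n s m \<phi> target)"
proof -
  have "1 \<le> n" if "U \<in> r_sets n 1" for U
    using that by (cases n) (auto simp: r_sets_def)
  then show ?thesis
    by (auto simp: valid_strategy_def embedding_strategy_def Let_def split: if_splits)
qed

lemma block_iff: "m > 0 \<Longrightarrow> \<tau> \<in> block m b \<longleftrightarrow> \<tau> div m = b"
  unfolding block_def atLeastLessThan_iff
  by (metis div_nat_eqI div_times_less_eq_dividend dividend_less_div_times mult.commute mult_Suc)

text \<open>\<open>recurrent\<close> for rank \<open>i\<close> reads only the \<open>d\<close>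
  blocks of that rank, so \<open>SOME\<close> picks the same vertex. This lets the player compute
  images from a prefix of the history.\<close>

lemma chosen_cong:
  assumes "\<And>j \<tau>. j < d \<Longrightarrow> \<tau> \<in> block m (i * d + j) \<Longrightarrow> f \<tau> = g \<tau>"
  shows "chosen n k d m f i = chosen n k d m g i"
proof -
  have "f ` block m (i * d + j) = g ` block m (i * d + j)" if "j < d" for j
    using assms[OF that] by (intro image_cong) auto
  then have "recurrent n k d m f i = recurrent n k d m g i"
    by (auto simp: recurrent_def)
  then show ?thesis by (simp add: chosen_def)
qed

lemma history_pmf_step:
  assumes n: "n \<ge> r" and h: "h \<in> set_pmf (history_pmf n r S t)"
  shows "length h = t \<and> (\<forall>\<tau><t. fst (h ! \<tau>) \<in> r_sets n r \<and>
            snd (h ! \<tau>) \<in> set_pmf (S (take \<tau> h) (fst (h ! \<tau>))))"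
  using h
proof (induction t arbitrary: h)
  case (Suc t)
  have fin: "finite (r_sets n r)"
    by (rule finite_subset[of _ "Pow {1..n}"]) (auto simp: r_sets_def)
  have "\<exists>U \<subseteq> {1..n}. card U = r" using n obtain_subset_with_card_n[of r "{1..n}"] by auto
  then have "r_sets n r \<noteq> {}" by (auto simp: r_sets_def)
  with Suc.prems fin obtain h' U V where h': "h' \<in> set_pmf (history_pmf n r S t)"
    "U \<in> r_sets n r" "V \<in> set_pmf (S h' U)" "h = h' @ [(U, V)]"
    by (auto simp: set_pmf_of_set)
  with Suc.IH[OF h'(1)] show ?case by (auto simp: nth_append less_Suc_eq)
qed simp

text \<open>The strategy only sees the past \<open>take \<tau> h\<close>, but this already determines the images of all
  vertices that precede the last vertex of the current edge.\<close>

lemma embedding_succeeds: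
  assumes G: "simple_hypergraph G" "uniform s G" and s: "s \<ge> 1"
    and rk: "bij_betw rk (verts G) {..<card (verts G)}"
    and apex: "\<And>e. e \<in># edges G \<Longrightarrow> apex e \<in># e"
    and before: "\<And>e w. e \<in># edges G \<Longrightarrow> w \<in># e - {#apex e#} \<Longrightarrow> rk w < rk (apex e)"
    and slot: "\<And>e. e \<in># edges G \<Longrightarrow> slot e < d"
    and target: "\<And>e. e \<in># edges G \<Longrightarrow> target (rk (apex e) * d + slot e) = e - {#apex e#}"
    and m: "m > 0" and t: "card (verts G) * d * m \<le> t" and n: "n \<ge> 1"
    and h: "h \<in> set_pmf (history_pmf n 1
      (embedding_strategy n s m (\<lambda>f v. chosen n (card (verts G)) d m f (rk v)) target) t)"
    and rec: "\<And>i. i < card (verts G) \<Longrightarrow> \<exists>u. recurrent n (card (verts G)) d m (draws h) i u"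
  shows "contains_copy (built_hypergraph n h) G"
proof -
  let ?k = "card (verts G)"
  define \<phi> where "\<phi> v = chosen n ?k d m (draws h) (rk v)" for v
  note step = history_pmf_step[OF n h]
  have len: "length h = t" using step by blast
  have sub: "set_mset e \<subseteq> verts G" if "e \<in># edges G" for e
    using G that by (auto simp: simple_hypergraph_def hypergraph_def)
  have rkk: "rk v < ?k" if "v \<in> verts G" for v using rk that by (auto simp: bij_betw_def)
  have \<phi>: "recurrent n ?k d m (draws h) (rk v) (\<phi> v)" if "v \<in> verts G" for v
    unfolding \<phi>_def chosen_def using rec[OF rkk[OF that]] by (rule someI_ex)
  show ?thesis
  proof (rule contains_copyI[OF G(1), of \<phi>])
    have "rk v = \<phi> v mod ?k" if "v \<in> verts G" for v using \<phi>[OF that] by (auto simp: recurrent_def)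
    then show "inj_on \<phi> (verts G)"
      using rk unfolding bij_betw_def inj_on_def by metis
    show "\<phi> ` verts G \<subseteq> verts (built_hypergraph n h)"
      using \<phi> by (auto simp: recurrent_def built_hypergraph_def)
    fix e assume e: "e \<in># edges G"
    let ?v = "apex e" and ?b = "rk (apex e) * d + slot e"
    have v: "?v \<in> verts G" using apex[OF e] sub[OF e] by auto
    obtain \<tau> where \<tau>: "\<tau> \<in> block m ?b" "draws h \<tau> = \<phi> ?v"
      using \<phi>[OF v] slot[OF e] by (auto simp: recurrent_def)
    have "Suc ?b \<le> Suc (rk ?v) * d" using slot[OF e] by simp
    also have "\<dots> \<le> ?k * d" using rkk[OF v] by (intro mult_right_mono) auto
    finally have "Suc ?b * m \<le> ?k * d * m" by (intro mult_right_mono) auto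
    then have \<tau>t: "\<tau> < t" using \<tau>(1) t by (auto simp: block_def)
    obtain U V where UV: "h ! \<tau> = (U, V)" by fastforce
    have "U \<in> r_sets n 1" using step \<tau>t UV by force
    then have U: "U = {\<phi> ?v}" using \<tau>(2) \<tau>t len UV
      by (auto simp: r_sets_def draws_def card_1_singleton_iff)
    have "V \<in> set_pmf (embedding_strategy n s m
        (\<lambda>f v. chosen n ?k d m f (rk v)) target (take \<tau> h) U)"
      using step \<tau>t UV by force
    moreover have "length (take \<tau> h) div m = ?b" using \<tau>(1) \<tau>t len m by (simp add: block_iff)
    moreover have "image_mset (\<lambda>v. chosen n ?k d m (draws (take \<tau> h)) (rk v)) (e - {#?v#})
        = image_mset \<phi> (e - {#?v#})"
    proof (rule image_mset_cong)
      fix w assume w: "w \<in># e - {#?v#}"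
      \<comment> \<open>The rank of \<open>w\<close> is smaller than that of the apex, so all blocks
        of \<open>w\<close> end before the block of \<open>e\<close> begins.\<close>
      have "draws (take \<tau> h) \<sigma> = draws h \<sigma>" if "j < d" "\<sigma> \<in> block m (rk w * d + j)" for j \<sigma>
      proof -
        have "Suc (rk w * d + j) \<le> Suc (rk w) * d" using that by simp
        also have "\<dots> \<le> rk ?v * d" using before[OF e w] by (intro mult_right_mono) auto
        also have "\<dots> \<le> ?b" by simp
        finally have "Suc (rk w * d + j) * m \<le> ?b * m" by (rule mult_right_mono) simp
        then have "\<sigma> < \<tau>" using that \<tau>(1) by (auto simp: block_def)
        then show ?thesis using \<tau>t len by (simp add: draws_def)
      qed
      then show "chosen n ?k d m (draws (take \<tau> h)) (rk w) = \<phi> w"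
        unfolding \<phi>_def by (intro chosen_cong)
    qed
    \<comment> \<open>This and the size below discharge the guard in
      \<open>embedding_strategy\<close>, so the answer is the intended one and not the
      fallback.\<close>
    moreover have "set_mset (image_mset \<phi> (e - {#?v#})) \<subseteq> {1..n}"
    proof
      fix x assume "x \<in># image_mset \<phi> (e - {#?v#})"
      then obtain w where "w \<in># e" "x = \<phi> w" by (auto dest: in_diffD)
      then show "x \<in> {1..n}" using \<phi>[of w] sub[OF e] by (auto simp: recurrent_def)
    qed
    moreover have "size (e - {#?v#}) = s - 1"
      using apex[OF e] e G(2) by (simp add: uniform_def size_Diff_singleton)
    ultimately have "V = image_mset \<phi> (e - {#?v#})"
      by (simp only: embedding_strategy_def Let_def target[OF e] set_return_pmf singleton_iff if_True simp_thms size_image_mset)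
    then have "mset_set U + V = image_mset \<phi> e"
      using U apex[OF e] by (simp flip: image_mset_add_mset)
    moreover have "h ! \<tau> \<in> set h" using \<tau>t len by simp
    ultimately show "image_mset \<phi> e \<in># edges (built_hypergraph n h)"
      unfolding built_hypergraph_def using UV by force
  qed
qed

section \<open>The distribution of the drawn vertices\<close>

lemma r_sets_1: "r_sets n 1 = (\<lambda>u. {u}) ` {1..n}"
  by (auto simp: r_sets_def card_1_singleton_iff)

lemma history_pmf_length: "h \<in> set_pmf (history_pmf n r S t) \<Longrightarrow> length h = t"
  by (induction t arbitrary: h) auto

text \<open>Each step sets \<open>draws\<close> at one new index to an independent uniform vertex,
  whatever the player answers. Events about the draws can thus be studied in a product space that
  does not involve the strategy.\<close>

lemma map_draws_history_pmf:
  assumes n: "n \<ge> 1"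
  shows "map_pmf draws (history_pmf n 1 S t) = Pi_pmf {..<t} 0 (\<lambda>_. pmf_of_set {1..n})"
proof (induction t)
  case 0
  then show ?case by (simp add: draws_def)
next
  case (Suc t)
  let ?P = "pmf_of_set {1..n}"
  have U: "pmf_of_set (r_sets n 1) = map_pmf (\<lambda>u. {u}) ?P"
    unfolding r_sets_1 using n by (intro map_pmf_of_set_inj[symmetric]) auto
  have app: "draws (h @ [({u}, V)]) = (draws h)(t := u)" if "h \<in> set_pmf (history_pmf n 1 S t)" for h u V
    using history_pmf_length[OF that] by (auto simp: draws_def fun_eq_iff nth_append)
  have "map_pmf draws (history_pmf n 1 S (Suc t)) =
      bind_pmf (history_pmf n 1 S t) (\<lambda>h. bind_pmf ?P (\<lambda>u. return_pmf ((draws h)(t := u))))"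
    unfolding history_pmf.simps U map_bind_pmf bind_map_pmf map_return_pmf
    by (intro bind_pmf_cong refl) (simp add: app)
  also have "\<dots> = bind_pmf (map_pmf draws (history_pmf n 1 S t))
      (\<lambda>f. bind_pmf ?P (\<lambda>u. return_pmf (f(t := u))))"
    by (simp add: bind_map_pmf)
  also have "\<dots> = bind_pmf ?P (\<lambda>u. bind_pmf (Pi_pmf {..<t} 0 (\<lambda>_. ?P)) (\<lambda>f. return_pmf (f(t := u))))"
    unfolding Suc by (rule bind_commute_pmf)
  also have "\<dots> = Pi_pmf {..<Suc t} 0 (\<lambda>_. ?P)"
    unfolding lessThan_Suc by (subst Pi_pmf_insert') auto
  finally show ?case .
qed

section \<open>Second moment bound and independent blocks\<close>

text \<open>Chebyshev's argument for the number \<open>X\<close> of events that occur: its mean is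
  \<mu> = \<open>card C * a\<close>, its variance is at most \<mu>, and
  \<open>(X x - \<mu>)\<^sup>2\<close> equals \<open>\<mu>\<^sup>2\<close> wherever \<open>X\<close>
  vanishes.\<close>

lemma prob_no_event_second_moment:
  fixes P :: "'b pmf" and A :: "'a \<Rightarrow> 'b set" and a :: real
  assumes C: "finite C"
    and a: "\<And>u. u \<in> C \<Longrightarrow> measure_pmf.prob P (A u) = a"
    and neg: "\<And>u v. u \<in> C \<Longrightarrow> v \<in> C \<Longrightarrow> u \<noteq> v \<Longrightarrow> measure_pmf.prob P (A u \<inter> A v) \<le> a\<^sup>2"
    and pos: "card C * a > 0"
  shows "measure_pmf.prob P {x. \<forall>u\<in>C. x \<notin> A u} \<le> 1 / (card C * a)"
proof -
  define \<mu> where "\<mu> = card C * a"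
  define X :: "'b \<Rightarrow> real" where "X x = (\<Sum>u\<in>C. indicator (A u) x)" for x
  have int1: "integrable P (\<lambda>x. indicator (B :: 'b set) x :: real)" for B
    by (intro measure_pmf.integrable_const_bound[where B=1]) auto
  have X2: "(X x)\<^sup>2 = (\<Sum>u\<in>C. \<Sum>v\<in>C. indicator (A u \<inter> A v) x)" for x
    by (simp add: X_def power2_eq_square sum_product indicator_inter_arith)
  have iX: "integrable P X" and iX2: "integrable P (\<lambda>x. (X x)\<^sup>2)"
    unfolding X2 unfolding X_def by (intro Bochner_Integration.integrable_sum int1)+
  have EX: "measure_pmf.expectation P X = \<mu>"
    unfolding X_def by (subst Bochner_Integration.integral_sum) (auto simp: int1 a \<mu>_def)
  have a0: "a \<ge> 0" using pos by (simp add: zero_less_mult_iff)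
  have "measure_pmf.expectation P (\<lambda>x. (X x)\<^sup>2)
      = (\<Sum>u\<in>C. \<Sum>v\<in>C. measure_pmf.prob P (A u \<inter> A v))"
    unfolding X2 by (simp add: Bochner_Integration.integral_sum int1 Bochner_Integration.integrable_sum)
  \<comment> \<open>Pairs with \<open>u = v\<close> contribute \<open>a\<close>, all others at most
    \<open>a\<^sup>2\<close>; allowing \<open>a\<^sup>2\<close> on the diagonal as well makes the
    double sum factor.\<close>
  also have "\<dots> \<le> (\<Sum>u\<in>C. \<Sum>v\<in>C. (if u = v then a else 0) + a\<^sup>2)"
    using a neg a0 by (intro sum_mono) auto
  also have "\<dots> = \<mu> + \<mu>\<^sup>2"
    using C by (simp add: sum.distrib \<mu>_def power2_eq_square algebra_simps)
  finally have EX2: "measure_pmf.expectation P (\<lambda>x. (X x)\<^sup>2) \<le> \<mu> + \<mu>\<^sup>2" .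
  let ?N = "{x. \<forall>u\<in>C. x \<notin> A u}"
  have "\<mu>\<^sup>2 * measure_pmf.prob P ?N = measure_pmf.expectation P (\<lambda>x. \<mu>\<^sup>2 * indicator ?N x)"
    by simp
  also have "\<dots> \<le> measure_pmf.expectation P (\<lambda>x. (X x)\<^sup>2 - 2 * \<mu> * X x + \<mu>\<^sup>2)"
  proof (rule integral_mono)
    show "integrable P (\<lambda>x. \<mu>\<^sup>2 * indicator ?N x)" by (intro integrable_mult_right int1)
    show "integrable P (\<lambda>x. (X x)\<^sup>2 - 2 * \<mu> * X x + \<mu>\<^sup>2)"
      using iX iX2 by (intro Bochner_Integration.integrable_add Bochner_Integration.integrable_diff
        integrable_mult_right) auto
    fix x
    have "X x = 0" if "x \<in> ?N" using that by (simp add: X_def)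
    moreover have "(X x)\<^sup>2 - 2 * \<mu> * X x + \<mu>\<^sup>2 = (X x - \<mu>)\<^sup>2" by (simp add: power2_diff)
    ultimately show "\<mu>\<^sup>2 * indicator ?N x \<le> (X x)\<^sup>2 - 2 * \<mu> * X x + \<mu>\<^sup>2"
      by (auto simp: indicator_def)
  qed
  also have "\<dots> = measure_pmf.expectation P (\<lambda>x. (X x)\<^sup>2) - 2 * \<mu> * \<mu> + \<mu>\<^sup>2"
    using iX iX2 EX by simp
  also have "\<dots> \<le> \<mu>" using EX2 by (simp add: power2_eq_square)
  finally have "\<mu> * (\<mu> * measure_pmf.prob P ?N) \<le> \<mu> * 1"
    by (simp add: power2_eq_square mult.assoc)
  moreover have \<mu>: "\<mu> > 0" using pos by (simp add: \<mu>_def)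
  ultimately have "\<mu> * measure_pmf.prob P ?N \<le> 1" by (simp only: mult_le_cancel_left_pos)
  then show ?thesis using \<mu> unfolding \<mu>_def[symmetric] by (simp add: field_simps)
qed

lemma prob_pair_pmf_Times:
  "measure_pmf.prob (pair_pmf M N) (A \<times> B) = measure_pmf.prob M A * measure_pmf.prob N B"
proof -
  \<comment> \<open>Cutting both factors down to the supports changes no probability and makes them
    countable.\<close>
  have "measure_pmf.prob (pair_pmf M N) (A \<times> B)
      = measure_pmf.prob (pair_pmf M N) ((A \<inter> set_pmf M) \<times> (B \<inter> set_pmf N))"
    by (intro measure_prob_cong_0) (auto simp: pmf_pair set_pmf_iff)
  also have "\<dots> = measure_pmf.prob M (A \<inter> set_pmf M) * measure_pmf.prob N (B \<inter> set_pmf N)"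
    by (rule measure_pmf_prob_product) auto
  finally show ?thesis by (simp add: measure_Int_set_pmf)
qed

text \<open>Independence of events that read disjoint sets of coordinates:
  \<open>Pi_pmf_union\<close> splits off one block as a factor of a pair, and by hypothesis
  \<open>Q\<close> each event ignores the coordinates outside its block.\<close>

lemma prob_Pi_pmf_blocks:
  assumes "finite B" and J: "\<And>b. b \<in> B \<Longrightarrow> finite (J b)" "disjoint_family_on J B"
    and Q: "\<And>b f g. b \<in> B \<Longrightarrow> (\<And>x. x \<in> J b \<Longrightarrow> f x = g x) \<Longrightarrow> Q b f = Q b g"
  shows "measure_pmf.prob (Pi_pmf (\<Union>b\<in>B. J b) dflt p) {f. \<forall>b\<in>B. Q b f}
    = (\<Prod>b\<in>B. measure_pmf.prob (Pi_pmf (J b) dflt p) {f. Q b f})"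
  using assms
proof (induction B rule: finite_induct)
  case (insert c B)
  let ?U = "\<Union>b\<in>B. J b"
  have disj: "J c \<inter> ?U = {}"
    using insert.prems(2) insert.hyps by (auto simp: disjoint_family_on_def)
  have fin: "finite (J c)" "finite ?U" using insert.prems(1) insert.hyps(1) by auto
  have 1: "Q c (\<lambda>x. if x \<in> J c then f x else g x) = Q c f" for f g
    by (rule insert.prems(3)) auto
  have 2: "Q b (\<lambda>x. if x \<in> J c then f x else g x) = Q b g" if "b \<in> B" for b f g
    using that disj by (intro insert.prems(3)) auto
  have "measure_pmf.prob (Pi_pmf (\<Union>b\<in>insert c B. J b) dflt p) {f. \<forall>b\<in>insert c B. Q b f}
      = measure_pmf.prob (pair_pmf (Pi_pmf (J c) dflt p) (Pi_pmf ?U dflt p))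
          ({f. Q c f} \<times> {f. \<forall>b\<in>B. Q b f})"
    unfolding UN_insert using fin disj
    by (subst Pi_pmf_union) (auto simp: measure_map_pmf 1 2 intro!: arg_cong2[where f=measure])
  also have "\<dots> = measure_pmf.prob (Pi_pmf (J c) dflt p) {f. Q c f} *
      measure_pmf.prob (Pi_pmf ?U dflt p) {f. \<forall>b\<in>B. Q b f}"
    by (rule prob_pair_pmf_Times)
  also have "measure_pmf.prob (Pi_pmf ?U dflt p) {f. \<forall>b\<in>B. Q b f}
      = (\<Prod>b\<in>B. measure_pmf.prob (Pi_pmf (J b) dflt p) {f. Q b f})"
  proof (rule insert.IH)
    show "disjoint_family_on J B" using insert.prems(2) by (auto simp: disjoint_family_on_def)
    show "Q b f = Q b g" if "b \<in> B" "\<And>x. x \<in> J b \<Longrightarrow> f x = g x" for b f g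
      using that by (intro insert.prems(3)) auto
  qed (use insert.prems(1) in auto)
  finally show ?case using insert.hyps by simp
qed simp

lemma prob_avoid:
  assumes "finite J" "n \<ge> 1" "A \<subseteq> {1..n::nat}"
  shows "measure_pmf.prob (Pi_pmf J dflt (\<lambda>_. pmf_of_set {1..n})) {f. \<forall>\<tau>\<in>J. f \<tau> \<notin> A}
    = (1 - card A / n) ^ card J"
proof -
  have "{f. \<forall>\<tau>\<in>J. f \<tau> \<notin> A} = Pi J (\<lambda>_. - A)" by auto
  moreover have "measure_pmf.prob (pmf_of_set {1..n}) (- A) = 1 - card A / n"
    using assms(2,3) measure_pmf.prob_compl[of A "pmf_of_set {1..n}"]
    by (simp add: measure_pmf_of_set Int_absorb1 Compl_eq_Diff_UNIV)
  ultimately show ?thesis using assms by (simp add: measure_Pi_pmf_Pi)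
qed

text \<open>The probability that a fixed one of \<open>n\<close> vertices occurs among
  \<open>m\<close> independent uniform draws.\<close>

definition hit_prob :: "nat \<Rightarrow> nat \<Rightarrow> real" where
  "hit_prob n m = 1 - (1 - 1 / n) ^ m"

lemma prob_hit:
  assumes "finite J" "u \<in> {1..n::nat}"
  shows "measure_pmf.prob (Pi_pmf J dflt (\<lambda>_. pmf_of_set {1..n})) {f. u \<in> f ` J}
    = hit_prob n (card J)"
proof -
  let ?P = "Pi_pmf J dflt (\<lambda>_. pmf_of_set {1..n})"
  have "{f. u \<in> f ` J} = UNIV - {f. \<forall>\<tau>\<in>J. f \<tau> \<notin> {u}}" by auto
  then have "measure_pmf.prob ?P {f. u \<in> f ` J} = 1 - measure_pmf.prob ?P {f. \<forall>\<tau>\<in>J. f \<tau> \<notin> {u}}"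
    using measure_pmf.prob_compl[of "{f. \<forall>\<tau>\<in>J. f \<tau> \<notin> {u}}" ?P] by simp
  then show ?thesis using prob_avoid[of J n "{u}" dflt] assms by (simp add: hit_prob_def)
qed

text \<open>With m = \<open>card J\<close>, inclusion-exclusion over the missed vertices gives 1 - 2
  (1 - 1/n)^m + (1 - 2/n)^m. The negative correlation then comes from 1 - 2/n \<le> (1 -
  1/n)^2.\<close>

lemma prob_hit_two:
  assumes J: "finite J" and uv: "u \<in> {1..n::nat}" "v \<in> {1..n}" "u \<noteq> v"
  shows "measure_pmf.prob (Pi_pmf J dflt (\<lambda>_. pmf_of_set {1..n})) {f. u \<in> f ` J \<and> v \<in> f ` J}
    \<le> (hit_prob n (card J))\<^sup>2"
proof -
  let ?P = "Pi_pmf J dflt (\<lambda>_. pmf_of_set {1..n})"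
  let ?m = "card J"
  let ?A = "\<lambda>B. {f. \<forall>\<tau>\<in>J. f \<tau> \<notin> B}"
  have n: "n \<ge> 2" using uv by auto
  have "{f. u \<in> f ` J \<and> v \<in> f ` J} = UNIV - (?A {u} \<union> ?A {v})" by auto
  then have "measure_pmf.prob ?P {f. u \<in> f ` J \<and> v \<in> f ` J} = 1 - measure_pmf.prob ?P (?A {u} \<union> ?A {v})"
    using measure_pmf.prob_compl[of "?A {u} \<union> ?A {v}" ?P] by simp
  also have "measure_pmf.prob ?P (?A {u} \<union> ?A {v})
      = measure_pmf.prob ?P (?A {u}) + measure_pmf.prob ?P (?A {v} - ?A {u})"
    by (rule measure_pmf.finite_measure_Union') auto
  also have "measure_pmf.prob ?P (?A {v} - ?A {u})
      = measure_pmf.prob ?P (?A {v}) - measure_pmf.prob ?P (?A {v} \<inter> ?A {u})"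
    by (rule measure_pmf.finite_measure_Diff') auto
  also have "?A {v} \<inter> ?A {u} = ?A {u, v}" by auto
  finally have "measure_pmf.prob ?P {f. u \<in> f ` J \<and> v \<in> f ` J}
      = 1 - 2 * (1 - 1 / n) ^ ?m + (1 - 2 / n) ^ ?m"
    using prob_avoid[OF J, of n "{u}" dflt] prob_avoid[OF J, of n "{v}" dflt]
      prob_avoid[OF J, of n "{u, v}" dflt] uv n by simp
  \<comment> \<open>Two distinct vertices force \<open>n \<ge> 2\<close>, so the base 1 - 2/n is
    nonnegative, as monotonicity of the power requires.\<close>
  also have "(1 - 2 / n) ^ ?m \<le> ((1 - 1 / n)\<^sup>2) ^ ?m"
    using n by (intro power_mono) (auto simp: power2_eq_square field_simps)
  also have "((1 - 1 / real n)\<^sup>2) ^ ?m = ((1 - 1 / n) ^ ?m)\<^sup>2"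
    by (simp only: power_mult[symmetric] mult.commute)
  also have "1 - 2 * (1 - 1 / n) ^ ?m + ((1 - 1 / n) ^ ?m)\<^sup>2 = (hit_prob n ?m)\<^sup>2"
    unfolding hit_prob_def power2_diff by simp
  finally show ?thesis by simp
qed

text \<open>Bernoulli's inequality for 1 + 1/n together with (1 - 1/n) (1 + 1/n) \<le> 1 bounds the
  probability of a miss by n / (n + m).\<close>

lemma hit_prob_ge:
  assumes "n \<ge> 1"
  shows "hit_prob n m \<ge> m / (real n + real m)"
proof -
  have "1 + m / n \<le> (1 + 1 / n) ^ m"
    using Bernoulli_inequality[of "1 / n" m] assms by (simp add: order_trans[of "-1" 0])
  then have "(1 - 1 / n) ^ m * (1 + m / n) \<le> (1 - 1 / n) ^ m * (1 + 1 / n) ^ m"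
    using assms by (intro mult_left_mono) auto
  also have "\<dots> = (1 - (1 / n)\<^sup>2) ^ m"
    by (simp add: power_mult_distrib[symmetric] power2_eq_square algebra_simps)
  also have "\<dots> \<le> 1" using assms by (intro power_le_one) (auto simp: power_le_one)
  finally show ?thesis using assms by (simp add: hit_prob_def field_simps)
qed

lemma card_residue_class_ge:
  assumes "i < k"
  shows "card {u \<in> {1..n::nat}. u mod k = i} \<ge> n div k"
proof -
  \<comment> \<open>The range starts at \<open>1\<close>, so residue \<open>0\<close> is represented
    by k, 2k, ... and not by 0, k, ....\<close>
  let ?g = "\<lambda>q. if i = 0 then Suc q * k else q * k + i"
  have "inj_on ?g {..<n div k}" using assms by (auto simp: inj_on_def split: if_splits)
  moreover have "?g ` {..<n div k} \<subseteq> {u \<in> {1..n}. u mod k = i}"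
  proof
    fix u assume "u \<in> ?g ` {..<n div k}"
    then obtain q where q: "q < n div k" "u = ?g q" by blast
    have "u \<le> Suc q * k" using q assms by auto
    also have "\<dots> \<le> n div k * k" using q by (intro mult_right_mono) auto
    also have "\<dots> \<le> n" by simp
    finally show "u \<in> {u \<in> {1..n}. u mod k = i}" using q assms by (auto simp del: mult_Suc)
  qed
  ultimately have "card {..<n div k} \<le> card {u \<in> {1..n}. u mod k = i}"
    by (rule card_inj_on_le) simp
  then show ?thesis by simp
qed

text \<open>A vertex of residue \<open>i\<close> is recurrent when it is hit in \<open>d\<close>
  disjoint blocks. By independence this has probability \<open>hit_prob n m ^ d\<close>, and for two
  such vertices jointly at most the square, so the second moment bound applies to the residue
  class.\<close>

lemma prob_no_recurrent:
  assumes n: "n \<ge> k" and i: "i < k" and m: "m > 0" and t: "k * d * m \<le> t"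
  shows "measure_pmf.prob (Pi_pmf {..<t} 0 (\<lambda>_. pmf_of_set {1..n}))
      {f. \<nexists>u. recurrent n k d m f i u} \<le> 1 / (real (n div k) * (m / (real n + real m)) ^ d)"
proof -
  let ?P = "Pi_pmf {..<t} 0 (\<lambda>_. pmf_of_set {1..n})"
  let ?B = "\<lambda>j. block m (i * d + j)"
  define C where "C = {u \<in> {1..n}. u mod k = i}"
  define a where "a = hit_prob n m ^ d"
  have n1: "n \<ge> 1" using n i by simp
  have sub: "(\<Union>j<d. ?B j) \<subseteq> {..<t}"
  proof
    fix \<tau> assume "\<tau> \<in> (\<Union>j<d. ?B j)"
    then obtain j where j: "j < d" "\<tau> < Suc (i * d + j) * m" by (auto simp: block_def)
    have "Suc (i * d + j) \<le> Suc i * d" using j by simp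
    also have "\<dots> \<le> k * d" using i by (intro mult_right_mono) auto
    finally have "Suc (i * d + j) * m \<le> k * d * m" by (rule mult_right_mono) simp
    then show "\<tau> \<in> {..<t}" using j t by simp
  qed
  have disj: "disjoint_family_on ?B {..<d}"
  proof (unfold disjoint_family_on_def, intro ballI impI)
    fix j j' :: nat assume "j \<noteq> j'"
    then have "Suc (i * d + j) \<le> i * d + j' \<or> Suc (i * d + j') \<le> i * d + j" by auto
    then have "Suc (i * d + j) * m \<le> (i * d + j') * m \<or> Suc (i * d + j') * m \<le> (i * d + j) * m"
      by (meson mult_le_mono1)
    then show "?B j \<inter> ?B j' = {}" by (auto simp: block_def simp del: mult_Suc)
  qed
  have cardB: "card (?B j) = m" for j by (simp add: block_def)
  have finB: "finite (?B j)" for j by (simp add: block_def)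
  \<comment> \<open>A general set \<open>W\<close> lets one product formula serve both a single
    vertex and a pair.\<close>
  have prod: "measure_pmf.prob ?P {f. \<forall>j<d. W \<subseteq> f ` ?B j}
      = (\<Prod>j<d. measure_pmf.prob (Pi_pmf (?B j) 0 (\<lambda>_. pmf_of_set {1..n})) {f. W \<subseteq> f ` ?B j})" for W
  proof -
    have eq: "(W \<subseteq> (\<lambda>x. if x \<in> (\<Union>j<d. ?B j) then f x else 0) ` ?B j) = (W \<subseteq> f ` ?B j)"
      if "j < d" for j and f :: "nat \<Rightarrow> nat"
      using that by (intro arg_cong[of _ _ "(\<subseteq>) W"] image_cong) auto
    have "measure_pmf.prob (Pi_pmf (\<Union>j<d. ?B j) 0 (\<lambda>_. pmf_of_set {1..n})) {f. \<forall>j\<in>{..<d}. W \<subseteq> f ` ?B j}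
      = (\<Prod>j<d. measure_pmf.prob (Pi_pmf (?B j) 0 (\<lambda>_. pmf_of_set {1..n})) {f. W \<subseteq> f ` ?B j})"
    proof (rule prob_Pi_pmf_blocks[OF _ finB disj])
      fix j and f g :: "nat \<Rightarrow> nat" assume "\<And>x. x \<in> ?B j \<Longrightarrow> f x = g x"
      then have "f ` ?B j = g ` ?B j" by (intro image_cong) auto
      then show "(W \<subseteq> f ` ?B j) = (W \<subseteq> g ` ?B j)" by simp
    qed auto
    \<comment> \<open>Restricting to the union of the blocks resets all other coordinates to the
      default \<open>0\<close>, which these events do not see.\<close>
    also have "measure_pmf.prob (Pi_pmf (\<Union>j<d. ?B j) 0 (\<lambda>_. pmf_of_set {1..n})) {f. \<forall>j\<in>{..<d}. W \<subseteq> f ` ?B j}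
        = measure_pmf.prob ?P {f. \<forall>j<d. W \<subseteq> f ` ?B j}"
      unfolding Pi_pmf_subset[OF finite_lessThan sub] measure_map_pmf vimage_def mem_Collect_eq
      using eq by (intro arg_cong2[where f=measure] Collect_cong refl) auto
    finally show ?thesis .
  qed
  define A where "A u = {f :: nat \<Rightarrow> nat. \<forall>j<d. u \<in> f ` ?B j}" for u
  have PA: "measure_pmf.prob ?P (A u) = a" if "u \<in> C" for u
    using prod[of "{u}"] prob_hit[OF finB, of u n] that by (simp add: A_def a_def cardB C_def)
  have PAA: "measure_pmf.prob ?P (A u \<inter> A v) \<le> a\<^sup>2" if "u \<in> C" "v \<in> C" "u \<noteq> v" for u v
  proof -
    have "A u \<inter> A v = {f. \<forall>j<d. {u, v} \<subseteq> f ` ?B j}" by (auto simp: A_def)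
    then have "measure_pmf.prob ?P (A u \<inter> A v)
      = (\<Prod>j<d. measure_pmf.prob (Pi_pmf (?B j) 0 (\<lambda>_. pmf_of_set {1..n})) {f. {u, v} \<subseteq> f ` ?B j})"
      using prod[of "{u, v}"] by (simp only:)
    also have "\<dots> \<le> (\<Prod>j<d. (hit_prob n m)\<^sup>2)"
      using prob_hit_two[OF finB, of u n v] that
      by (intro prod_mono) (auto simp: cardB C_def)
    also have "\<dots> = a\<^sup>2" by (simp add: a_def power_mult[symmetric] mult.commute)
    finally show ?thesis .
  qed
  have q0: "m / (real n + real m) > 0" using m by simp
  have le: "real (n div k) * (m / (real n + real m)) ^ d \<le> card C * a"
    unfolding a_def using hit_prob_ge[OF n1, of m] q0 card_residue_class_ge[OF i, of n]
    by (intro mult_mono power_mono) (auto simp: C_def)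
  have pos: "0 < real (n div k) * (m / (real n + real m)) ^ d"
    using n i q0 by (simp add: div_greater_zero_iff)
  have "{f. \<nexists>u. recurrent n k d m f i u} = {f. \<forall>u\<in>C. f \<notin> A u}"
    by (auto simp: recurrent_def A_def C_def)
  then have "measure_pmf.prob ?P {f. \<nexists>u. recurrent n k d m f i u} \<le> 1 / (card C * a)"
    using prob_no_event_second_moment[of C ?P A a] PA PAA le pos by (simp add: C_def)
  also have "\<dots> \<le> 1 / (real (n div k) * (m / (real n + real m)) ^ d)"
    using le pos by (intro divide_left_mono) auto
  finally show ?thesis .
qed

section \<open>The success probability and its limit\<close>

text \<open>A union bound over the ranks. The lack of a recurrent vertex is an event of the draws
  alone, so it can be measured in the product space although the player reacts to the draws.\<close>

lemma prob_embedding_ge: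
  assumes G: "simple_hypergraph G" "uniform s G" and s: "s \<ge> 1"
    and rk: "bij_betw rk (verts G) {..<card (verts G)}"
    and apex: "\<And>e. e \<in># edges G \<Longrightarrow> apex e \<in># e"
    and before: "\<And>e w. e \<in># edges G \<Longrightarrow> w \<in># e - {#apex e#} \<Longrightarrow> rk w < rk (apex e)"
    and slot: "\<And>e. e \<in># edges G \<Longrightarrow> slot e < d"
    and target: "\<And>e. e \<in># edges G \<Longrightarrow> target (rk (apex e) * d + slot e) = e - {#apex e#}"
    and m: "m > 0" and t: "card (verts G) * d * m \<le> t" and n: "n \<ge> card (verts G)" "n \<ge> 1"
  shows "measure_pmf.prob (semi_random_process n 1
      (embedding_strategy n s m (\<lambda>f v. chosen n (card (verts G)) d m f (rk v)) target) t)
      {H. contains_copy H G}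
    \<ge> 1 - card (verts G) * (1 / (real (n div card (verts G)) * (m / (real n + real m)) ^ d))"
proof -
  let ?k = "card (verts G)"
  let ?S = "embedding_strategy n s m (\<lambda>f v. chosen n ?k d m f (rk v)) target"
  let ?P = "Pi_pmf {..<t} 0 (\<lambda>_. pmf_of_set {1..n})"
  let ?bad = "\<lambda>i. {f. \<nexists>u. recurrent n ?k d m f i u}"
  have "measure_pmf.prob ?P (\<Union>i<?k. ?bad i) \<le> (\<Sum>i<?k. measure_pmf.prob ?P (?bad i))"
    by (rule measure_pmf.finite_measure_subadditive_finite) auto
  also have "\<dots> \<le> (\<Sum>i<?k. 1 / (real (n div ?k) * (m / (real n + real m)) ^ d))"
    by (intro sum_mono prob_no_recurrent[OF n(1) _ m t]) auto
  finally have bad: "measure_pmf.prob ?P (\<Union>i<?k. ?bad i)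
    \<le> ?k * (1 / (real (n div ?k) * (m / (real n + real m)) ^ d))" by simp
  have "1 - measure_pmf.prob ?P (\<Union>i<?k. ?bad i) = measure_pmf.prob ?P (UNIV - (\<Union>i<?k. ?bad i))"
    using measure_pmf.prob_compl[of "\<Union>i<?k. ?bad i" ?P] by simp
  also have "\<dots> = measure_pmf.prob (history_pmf n 1 ?S t)
      {h. \<forall>i<?k. \<exists>u. recurrent n ?k d m (draws h) i u}"
    unfolding map_draws_history_pmf[OF n(2), of ?S t, symmetric] measure_map_pmf
    by (intro arg_cong2[where f=measure]) auto
  \<comment> \<open>Success is known only for histories in the support, hence the inclusion almost
    everywhere.\<close>
  also have "\<dots> \<le> measure_pmf.prob (history_pmf n 1 ?S t)
      {h. contains_copy (built_hypergraph n h) G}"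
    using embedding_succeeds[OF G s rk apex before slot target m t n(2)]
    by (intro measure_pmf.finite_measure_mono_AE) (auto simp: AE_measure_pmf_iff)
  also have "\<dots> = measure_pmf.prob (semi_random_process n 1 ?S t) {H. contains_copy H G}"
    by (simp add: semi_random_process_def vimage_def)
  finally show ?thesis using bad by linarith
qed

text \<open>Let x = n^((d-1)/d), r = n^(1/d) and q = m/(n+m). Then x r = n and r^d = n, so 1/(r q) =
  x/m + 1/r and n q^d = (r q)^d. Here m/x tends to infinity with \<omega>, and r with n.\<close>

lemma block_length_asymptotics:
  fixes \<omega> :: "nat \<Rightarrow> real" and d k :: nat
  defines "m \<equiv> \<lambda>n. nat \<lfloor>real n powr ((real d - 1) / real d) * \<omega> n\<rfloor> div (k * d)"
  assumes d: "d \<ge> 1" and k: "k \<ge> 1" and \<omega>: "filterlim \<omega> at_top sequentially"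
  shows "eventually (\<lambda>n. m n > 0) sequentially"
    and "(\<lambda>n. 1 / (real (n div k) * (m n / (real n + real (m n))) ^ d)) \<longlonglongrightarrow> 0"
proof -
  define x where "x n = real n powr ((real d - 1) / real d)" for n
  define r where "r n = real n powr (1 / real d)" for n
  have x1: "x n \<ge> 1" if "n \<ge> 1" for n
    unfolding x_def using that d by (intro ge_one_powr_ge_zero) auto
  define D where "D = k * d"
  have D: "D \<ge> 1" using d k by (simp add: D_def)
  \<comment> \<open>The floor costs at most 1 and the division less than \<open>D\<close> steps;
    divided by \<open>D\<close> this is at most 1 + 1/D \<le> 2 \<le> 2 x, which accounts for the
    -2.\<close>
  have m_ge: "- 2 + inverse (real D) * \<omega> n \<le> m n / x n" if n: "n \<ge> 1" for n
  proof -
    let ?t = "nat \<lfloor>x n * \<omega> n\<rfloor>"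
    have "x n * \<omega> n - 1 \<le> ?t" by linarith
    also have "real ?t \<le> (m n + 1) * real D"
    proof -
      have "?t = m n * D + ?t mod D" unfolding m_def x_def D_def by (rule div_mult_mod_eq[symmetric])
      moreover have "?t mod D < D" using D by simp
      ultimately have "?t \<le> (m n + 1) * D" by (simp only: add_mult_distrib)
      then show ?thesis by (metis of_nat_le_iff of_nat_mult)
    qed
    finally have "x n * \<omega> n \<le> real D * m n + real D + 1" by (simp add: algebra_simps)
    then have "inverse (real D) * (x n * \<omega> n) \<le> inverse (real D) * (real D * m n + real D + 1)"
      by (rule mult_left_mono) simp
    also have "\<dots> = m n + 1 + inverse (real D)" using D by (simp add: algebra_simps)
    also have "\<dots> \<le> m n + 2 * x n"
      using x1[OF n] D inverse_le_1_iff[of "real D"] by linarith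
    finally show ?thesis using x1[OF n] by (simp add: field_simps)
  qed
  have "filterlim (\<lambda>n. inverse (real D) * \<omega> n) at_top sequentially"
    by (rule filterlim_tendsto_pos_mult_at_top[OF tendsto_const _ \<omega>]) (use D in simp)
  then have "filterlim (\<lambda>n. - 2 + inverse (real D) * \<omega> n) at_top sequentially"
    by (rule filterlim_tendsto_add_at_top[OF tendsto_const])
  then have lim: "filterlim (\<lambda>n. m n / x n) at_top sequentially"
    by (rule filterlim_at_top_mono[OF _ eventually_mono[OF eventually_ge_at_top[of 1] m_ge]])
  then have "eventually (\<lambda>n. m n / x n > 0) sequentially" by (simp add: filterlim_at_top_dense)
  then show ev: "eventually (\<lambda>n. m n > 0) sequentially"
    by eventually_elim (auto simp: zero_less_divide_iff)
  have "(\<lambda>n. inverse (m n / x n)) \<longlonglongrightarrow> 0"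
    using lim by (rule tendsto_inverse_0_at_top)
  moreover have "(\<lambda>n. inverse (r n)) \<longlonglongrightarrow> 0"
    unfolding r_def powr_minus[symmetric]
    by (rule tendsto_neg_powr[OF _ filterlim_real_sequentially]) (use d in simp)
  ultimately have "(\<lambda>n. (2 * k) * (inverse (m n / x n) + inverse (r n)) ^ d) \<longlonglongrightarrow> real (2 * k) * (0 + 0) ^ d"
    by (intro tendsto_intros)
  then have lim0: "(\<lambda>n. (2 * k) * (inverse (m n / x n) + inverse (r n)) ^ d) \<longlonglongrightarrow> 0"
    using d by (simp add: power_0_left)
  show "(\<lambda>n. 1 / (real (n div k) * (m n / (real n + real (m n))) ^ d)) \<longlonglongrightarrow> 0"
  proof (rule tendsto_sandwich[OF _ _ tendsto_const lim0])
    show "eventually (\<lambda>n. 0 \<le> 1 / (real (n div k) * (m n / (real n + real (m n))) ^ d)) sequentially"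
      by simp
    show "eventually (\<lambda>n. 1 / (real (n div k) * (m n / (real n + real (m n))) ^ d)
        \<le> (2 * k) * (inverse (m n / x n) + inverse (r n)) ^ d) sequentially"
      using ev eventually_ge_at_top[of k]
    proof eventually_elim
      case (elim n)
      define q where "q = m n / (real n + real (m n))"
      have n: "n \<ge> 1" using elim k by simp
      have q: "q > 0" using elim by (simp add: q_def)
      have nk1: "n div k \<ge> 1" using elim k by (simp add: div_greater_zero_iff Suc_le_eq)
      then have "k * 1 \<le> k * (n div k)" by (rule mult_left_mono) simp
      \<comment> \<open>The remainder of \<open>n\<close> modulo \<open>k\<close> is less than
        \<open>k\<close>, hence less than \<open>k * (n div k)\<close>; this is the source of the
        factor 2.\<close>
      then have "n \<le> 2 * (k * (n div k))"
        using mult_div_mod_eq[of k n] mod_less_divisor[of k n] k by linarith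
      then have "real n \<le> 2 * (real k * real (n div k))"
        by (metis of_nat_le_iff of_nat_mult of_nat_numeral)
      then have nk: "n / (2 * k) \<le> real (n div k)" using k by (simp add: field_simps)
      have rd: "r n ^ d = n" and r0: "r n > 0"
        using n d by (simp_all add: r_def powr_power)
      have "x n * r n = real n powr ((real d - 1) / real d + 1 / real d)"
        by (simp add: x_def r_def powr_add)
      also have "(real d - 1) / real d + 1 / real d = 1" using d by (simp add: field_simps)
      finally have xr: "x n * r n = n" using n by simp
      have "inverse (m n / x n) + inverse (r n) = (x n * r n + m n) / (r n * m n)"
        using elim r0 by (simp add: field_simps)
      also have "\<dots> = inverse (r n * q)" unfolding xr q_def by (simp add: inverse_eq_divide)
      finally have y: "inverse (m n / x n) + inverse (r n) = inverse (r n * q)" .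
      have "1 / (real (n div k) * q ^ d) \<le> 1 / (n / (2 * k) * q ^ d)"
        using nk nk1 n k q by (intro divide_left_mono mult_right_mono mult_pos_pos) auto
      also have "\<dots> = (2 * k) * inverse (r n * q) ^ d"
        unfolding power_inverse power_mult_distrib rd by (simp add: inverse_eq_divide)
      finally show ?case unfolding y unfolding q_def .
    qed
  qed
qed

theorem theorem1p4:
  fixes G :: "'a hypergraph" and s d :: nat and \<omega> :: "nat \<Rightarrow> real"
  assumes "s \<ge> 2"
    and "simple_hypergraph G" and "uniform s G"
    and "degeneracy G = d" and "d \<ge> 1"
    and "filterlim \<omega> at_top sequentially"
  shows "\<exists>S :: nat \<Rightarrow> strategy.
    (\<forall>n. valid_strategy n 1 s (S n)) \<and>
    (\<lambda>n. measure_pmf.prob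
            (semi_random_process n 1 (S n)
               (nat \<lfloor>real n powr ((real d - 1) / real d) * \<omega> n\<rfloor>))
            {H. contains_copy H G}) \<longlonglongrightarrow> 1"
proof -
  let ?k = "card (verts G)"
  define t where "t n = nat \<lfloor>real n powr ((real d - 1) / real d) * \<omega> n\<rfloor>" for n
  define m where "m n = t n div (?k * d)" for n
  have hG: "hypergraph G" using assms(2) by (simp add: simple_hypergraph_def)
  \<comment> \<open>Without vertices the condition in \<open>degenerate\<close> would be vacuous and
    the degeneracy \<open>0\<close>, contrary to \<open>d \<ge> 1\<close>.\<close>
  have "verts G \<noteq> {}"
  proof
    assume "verts G = {}"
    then have "degenerate 0 G" by (auto simp: degenerate_def subhypergraph_def)
    then have "degeneracy G \<le> 0" unfolding degeneracy_def by (rule Least_le)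
    then show False using assms(4,5) by simp
  qed
  then have k: "?k \<ge> 1" using hG by (simp add: hypergraph_def Suc_le_eq card_gt_0_iff)
  have deg: "degenerate d G" using degenerate_degeneracy[OF hG] assms(4) by simp
  have ne: "{#} \<notin># edges G" using assms(1,3) by (auto simp: uniform_def)
  obtain rk apex slot where rk: "bij_betw rk (verts G) {..<?k}"
    and apex: "\<forall>e\<in>#edges G. apex e \<in># e"
    and before: "\<forall>e\<in>#edges G. \<forall>w\<in>#e - {#apex e#}. rk w < (rk (apex e) :: nat)"
    and slot: "\<forall>e\<in>#edges G. slot e < d"
    and inj: "inj_on (\<lambda>e. rk (apex e) * d + slot e) (set_mset (edges G))"
    by (rule degenerate_edge_slots[OF assms(2) deg ne])
  \<comment> \<open>The inverse of the block numbering recovers the edge that a block serves; for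
    all other blocks the value is arbitrary.\<close>
  define target where "target b =
    (let e = inv_into (set_mset (edges G)) (\<lambda>e. rk (apex e) * d + slot e) b in e - {#apex e#})" for b
  have target: "target (rk (apex e) * d + slot e) = e - {#apex e#}" if "e \<in># edges G" for e
    unfolding target_def using inv_into_f_f[OF inj, of e] that by simp
  define S where "S n =
    embedding_strategy n s (m n) (\<lambda>f v. chosen n ?k d (m n) f (rk v)) target" for n
  let ?p = "\<lambda>n. measure_pmf.prob (semi_random_process n 1 (S n) (t n)) {H. contains_copy H G}"
  note lim = block_length_asymptotics[OF assms(5) k assms(6), folded t_def, folded m_def]
  have "?p \<longlonglongrightarrow> 1"
  proof (rule tendsto_sandwich[OF _ _ _ tendsto_const])
    have "(\<lambda>n. 1 - ?k * (1 / (real (n div ?k) * (m n / (real n + real (m n))) ^ d))) \<longlonglongrightarrow> 1 - real ?k * 0"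
      by (intro tendsto_intros lim(2))
    then show "(\<lambda>n. 1 - ?k * (1 / (real (n div ?k) * (m n / (real n + real (m n))) ^ d))) \<longlonglongrightarrow> 1" by simp
    show "eventually (\<lambda>n. 1 - ?k * (1 / (real (n div ?k) * (m n / (real n + real (m n))) ^ d)) \<le> ?p n) sequentially"
      using lim(1) eventually_ge_at_top[of ?k]
    proof eventually_elim
      case (elim n)
      have "?k * d * m n \<le> t n" unfolding m_def by simp
      then show ?case unfolding S_def
        using prob_embedding_ge[OF assms(2,3) _ rk, of apex slot d target "m n" "t n" n]
          elim k assms(1) apex before slot target by simp
    qed
  qed simp
  moreover have "\<forall>n. valid_strategy n 1 s (S n)"
    by (simp only: S_def valid_embedding_strategy simp_thms)
  ultimately show ?thesis unfolding t_def by blast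
qed

end
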